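(* Let $q\in(0,1]$, let $m,n,s$ be integers with $2\le 2s\le m\le n$, let $\mathbf A$ be a real $m\times n$ matrix with $\delta_{2s}(\mathbf A)\in(0,1)$, and set $$\delta_1:=\Big(\frac{1-\delta_{2s}(\mathbf A)}{1+\delta_{2s}(\mathbf A)}\Big)^{1/2}.$$ Then $\mathbf A$ has the null space property of order $s$ in $\ell^q$, and its null space constant is less than or equal to $a(q,\delta_1)/\delta_1$.
   Context: For $\mathbf x=(x_1,\dots,x_n)^T\in\mathbb R^n$ and $0<q<\infty$, $\|\mathbf x\|_q=(|x_1|^q+\cdots+|x_n|^q)^{1/q}$. $\Sigma_k$ is the set of vectors in $\mathbb R^n$ with at most $k$ nonzero components. The restricted isometry constant $\delta_k(\mathbf A)$ of order $k$ is the smallest $\delta\ge0$ such that $(1-\delta)\|\mathbf x\|_2^2\le\|\mathbf A\mathbf x\|_2^2\le(1+\delta)\|\mathbf x\|_2^2$ for all $\mathbf x\in\Sigma_k$. For $S\subset\{1,\dots,n\}$ and $\mathbf v\in\mathbb R^n$, $\mathbf v_S$ is the vector equal to $\mathbf v$ on $S$ and vanishing on the complement $S^c$. The matrix $\mathbf A$ has the null space property of order $s$ in $\ell^q$ if there is a positive constant $\gamma$ such that $\|\mathbf h_S\|_q\le\gamma\|\mathbf h_{S^c}\|_q$ for all $\mathbf h\in\mathbb R^n$ with $\mathbf A\mathbf h=\mathbf 0$ and all sets $S\subset\{1,\dots,n\}$ with $\#S\le s$; the minimal such $\gamma$ (infimum) is the null space constant. For $0<q\le1$ and $\delta\in(0,1)$,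 $$a(q,\delta):=\inf_{0<r_0<1}\max\Big\{\frac{1+r_0\delta}{(1+r_0^q\delta^q)^{1/q}},\ \sup_{\sqrt2(1-r_0)\delta/2\le y\le1}\frac{2y}{(1+2^{-q/2}y^{2+q})^{1/q}},\ \sup_{\sqrt2(1-r_0)\delta/2\le y\le1}\frac{3y}{(1+y)^{1/q}},\ \sup_{y\ge1}\frac{2y}{(1+y)^{1/q}}\Big\}.$$ *)

theory Defs
  imports "HOL-Analysis.Analysis"
begin

definition lq_norm :: "real \<Rightarrow> real ^ 'n \<Rightarrow> real" where
  "lq_norm q x = (\<Sum>i\<in>UNIV. \<bar>x $ i\<bar> powr q) powr (1 / q)"

definition sparse_vecs :: "nat \<Rightarrow> (real ^ 'n) set" where
  "sparse_vecs k = {x. card {i. x $ i \<noteq> 0} \<le> k}"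

(* norm on real ^ 'n is the Euclidean norm. *)
definition rip_bound :: "real ^ 'n ^ 'm \<Rightarrow> nat \<Rightarrow> real \<Rightarrow> bool" where
  "rip_bound A k \<delta> \<longleftrightarrow>
     (\<forall>x\<in>sparse_vecs k. (1 - \<delta>) * (norm x)\<^sup>2 \<le> (norm (A *v x))\<^sup>2 \<and>
                         (norm (A *v x))\<^sup>2 \<le> (1 + \<delta>) * (norm x)\<^sup>2)"

(* The infimum is attained (rip_const_least below), so this is the smallest admissible \<delta>. *)
definition rip_const :: "real ^ 'n ^ 'm \<Rightarrow> nat \<Rightarrow> real" where
  "rip_const A k = Inf {\<delta>. 0 \<le> \<delta> \<and> rip_bound A k \<delta>}"

definition restrict_vec :: "real ^ 'n \<Rightarrow> 'n set \<Rightarrow> real ^ 'n" where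
  "restrict_vec v S = (\<chi> i. if i \<in> S then v $ i else 0)"

definition nsp_bound :: "real ^ 'n ^ 'm \<Rightarrow> nat \<Rightarrow> real \<Rightarrow> real \<Rightarrow> bool" where
  "nsp_bound A s q \<gamma> \<longleftrightarrow>
     (\<forall>h S. A *v h = 0 \<and> card S \<le> s \<longrightarrow>
        lq_norm q (restrict_vec h S) \<le> \<gamma> * lq_norm q (restrict_vec h (- S)))"

definition null_space_property :: "real ^ 'n ^ 'm \<Rightarrow> nat \<Rightarrow> real \<Rightarrow> bool" where
  "null_space_property A s q \<longleftrightarrow> (\<exists>\<gamma>>0. nsp_bound A s q \<gamma>)"

(* Only meaningful under null_space_property: otherwise the infimum is over the empty set. *)
definition null_space_const :: "real ^ 'n ^ 'm \<Rightarrow> nat \<Rightarrow> real \<Rightarrow> real" where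
  "null_space_const A s q = Inf {\<gamma>. 0 < \<gamma> \<and> nsp_bound A s q \<gamma>}"

(* For 0 < q \<le> 1 and 0 < \<delta> < 1 every supremum below is over a nonempty set of reals
   contained in [0, 3], and the infimum is over a nonempty set bounded below by 0,
   so the real-valued SUP and INF have their usual meaning. *)
definition a_fun :: "real \<Rightarrow> real \<Rightarrow> real" where
  "a_fun q \<delta> =
     (INF r\<in>{0<..<1}.
        max ((1 + r * \<delta>) / (1 + r powr q * \<delta> powr q) powr (1 / q))
       (max (SUP y\<in>{sqrt 2 * (1 - r) * \<delta> / 2..1}.
               2 * y / (1 + 2 powr (- q / 2) * y powr (2 + q)) powr (1 / q))
       (max (SUP y\<in>{sqrt 2 * (1 - r) * \<delta> / 2..1}. 3 * y / (1 + y) powr (1 / q))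
            (SUP y\<in>{1..}. 2 * y / (1 + y) powr (1 / q)))))"

lemma rip_const_least:
  fixes A :: "real ^ 'n ^ 'm"
  shows "0 \<le> rip_const A k" "rip_bound A k (rip_const A k)"
    and "0 \<le> \<delta> \<Longrightarrow> rip_bound A k \<delta> \<Longrightarrow> rip_const A k \<le> \<delta>"
proof -
  let ?D = "{\<delta>. 0 \<le> \<delta> \<and> rip_bound A k \<delta>}"
  obtain K where K: "K > 0" "\<And>x. norm (A *v x) \<le> K * norm x"
    using linear_bounded_pos[OF matrix_vector_mul_linear[of A]] by auto
  have "rip_bound A k (1 + K\<^sup>2)"
    unfolding rip_bound_def
  proof (intro ballI conjI)
    fix x :: "real ^ 'n"
    have "(1 - (1 + K\<^sup>2)) * (norm x)\<^sup>2 \<le> 0"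
      by (simp add: mult_le_0_iff)
    then show "(1 - (1 + K\<^sup>2)) * (norm x)\<^sup>2 \<le> (norm (A *v x))\<^sup>2"
      using zero_le_power2[of "norm (A *v x)"] by linarith
    have "(norm (A *v x))\<^sup>2 \<le> (K * norm x)\<^sup>2"
      using K(2)[of x] by (intro power_mono) auto
    also have "\<dots> \<le> (1 + (1 + K\<^sup>2)) * (norm x)\<^sup>2"
      unfolding power_mult_distrib by (intro mult_right_mono) auto
    finally show "(norm (A *v x))\<^sup>2 \<le> (1 + (1 + K\<^sup>2)) * (norm x)\<^sup>2" .
  qed
  then have ne: "?D \<noteq> {}"
    using zero_le_power2[of K] by (intro ex_in_conv[THEN iffD1] exI[of _ "1 + K\<^sup>2"]) auto
  have bdd: "bdd_below ?D"
    by (rule bdd_belowI[of _ 0]) auto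
  have D: "?D = {0..} \<inter> (\<Inter>x\<in>sparse_vecs k.
      {\<delta>. (1 - \<delta>) * (norm x)\<^sup>2 \<le> (norm (A *v x))\<^sup>2} \<inter>
      {\<delta>. (norm (A *v x))\<^sup>2 \<le> (1 + \<delta>) * (norm x)\<^sup>2})"
    by (auto simp: rip_bound_def)
  have "closed ?D"
    unfolding D by (intro closed_Int closed_INT ballI closed_Collect_le continuous_intros closed_atLeast)
  then have "Inf ?D \<in> ?D"
    using closed_contains_Inf[OF ne bdd] by blast
  then show "0 \<le> rip_const A k" "rip_bound A k (rip_const A k)"
    by (auto simp: rip_const_def)
  show "rip_const A k \<le> \<delta>" if "0 \<le> \<delta>" "rip_bound A k \<delta>"
    unfolding rip_const_def using that by (intro cInf_lower bdd) auto
qed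

end

theory Submission
  imports Defs
begin

text \<open>
  Sort the moduli of a null vector h decreasingly and cut them into consecutive blocks of length s.
  Let P j be the Euclidean norm and c j the least entry of block j, and let T be the sum of
  the P j over j \<ge> 2. Applying the restricted isometry bounds to the first two blocks
  together and to each later block separately gives
  \<delta>1 sqrt (P 0^2 + P 1^2) \<le> T. After scaling so that c 1 = 1 and s = 1, write
  p = P 2 \<le> 1, u = c 2 + c 3 + ... and y = max p u. Since P (j + 1) \<le> c j, we have
  T \<le> p + u \<le> 2 y, whereas P 0, P 1 \<ge> 1 forces y \<ge> sqrt 2 \<delta>1 / 2. The q-th
  power of the tail norm is at least 1 + p^2 and at least 1 + u, because entries beyond
  block 1 are at most 1. The case p = y yields the second term in the definition
  of a, the case u = y the third or the fourth one; neither the first term nor the slack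
  1 - r is used.
\<close>

section \<open>Power inequalities for finite sums\<close>

text \<open>Young's inequality for \<open>t\<close> and 1 with weights \<open>a\<close> and
  \<open>1 - a\<close>: the concave function t^a lies below its tangent at 1.\<close>

lemma powr_le_tangent:
  fixes t a :: real
  assumes "0 \<le> t" "0 \<le> a" "a \<le> 1"
  shows "t powr a \<le> 1 + a * (t - 1)"
proof (cases "t = 0")
  case True
  then show ?thesis using assms by simp
next
  case False
  then have "t powr a * 1 powr (1 - a) \<le> a * t + (1 - a) * 1"
    using assms by (intro Youngs_inequality_0) auto
  then show ?thesis by (simp add: algebra_simps)
qed

text \<open>Power mean inequality between the exponents q and 2, with \<open>m\<close> the root mean
  square of \<open>g\<close> on \<open>B\<close>. The tangent bound is applied to (g k / m)^2 with
  exponent q / 2; its linear terms cancel in the sum because these squares have mean 1.\<close>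

lemma sum_powr_le_mean_square:
  fixes g :: "'a \<Rightarrow> real"
  assumes fin: "finite B" and q: "0 < q" "q \<le> 2" and g: "\<And>k. k \<in> B \<Longrightarrow> 0 \<le> g k"
    and m: "0 < m" "(\<Sum>k\<in>B. (g k)\<^sup>2) = real (card B) * m\<^sup>2"
  shows "(\<Sum>k\<in>B. g k powr q) \<le> real (card B) * m powr q"
proof -
  have "g k powr q \<le> m powr q * (1 + q / 2 * ((g k)\<^sup>2 / m\<^sup>2 - 1))" if "k \<in> B" for k
  proof -
    have gk: "0 \<le> g k" using g that by simp
    have "(g k / m) powr q = ((g k / m)\<^sup>2) powr (q / 2)"
      using gk m by (cases "g k = 0") (simp_all flip: powr_numeral add: powr_powr)
    also have "\<dots> \<le> 1 + q / 2 * ((g k / m)\<^sup>2 - 1)"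
      using q by (intro powr_le_tangent) auto
    finally have "m powr q * (g k / m) powr q \<le> m powr q * (1 + q / 2 * ((g k)\<^sup>2 / m\<^sup>2 - 1))"
      by (intro mult_left_mono) (auto simp: power_divide)
    then show ?thesis using gk m by (simp add: powr_divide)
  qed
  then have "(\<Sum>k\<in>B. g k powr q) \<le> (\<Sum>k\<in>B. m powr q * (1 + q / 2 * ((g k)\<^sup>2 / m\<^sup>2 - 1)))"
    by (rule sum_mono)
  also have "\<dots> = m powr q * (real (card B) + q / 2 * ((\<Sum>k\<in>B. (g k)\<^sup>2) / m\<^sup>2 - real (card B)))"
    by (simp add: sum.distrib sum_subtractf flip: sum_distrib_left sum_divide_distrib)
  also have "\<dots> = real (card B) * m powr q"
    using m by simp
  finally show ?thesis .
qed

section \<open>Block estimate for a decreasing sequence\<close>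

text \<open>With Q = W 1 + W 2 + ... the chain is d W0^(1/q) \<le> d s^(1/q - 1/2) P0 \<le> s^(1/q -
  1/2) T \<le> s^(1/q) c1 2y \<le> M Q^(1/q). The hypotheses \<open>M1\<close> and \<open>M2\<close>
  are what the last link asks of \<open>M\<close> in the cases y = p and y = u. The bound on
  \<open>J\<close> guarantees that block 2 is among the blocks summed.\<close>

lemma decreasing_blocks_bound:
  fixes g :: "nat \<Rightarrow> real" and P W :: "nat \<Rightarrow> real"
  assumes g0: "\<And>k. 0 \<le> g k" and dec: "antimono g"
    and s: "0 < s" and J: "3 \<le> J" and q: "0 < q" "q \<le> 1" and d: "0 < d"
    and P_def: "\<And>j. P j = sqrt (\<Sum>k\<in>{j * s..<j * s + s}. (g k)\<^sup>2)"
    and W_def: "\<And>j. W j = (\<Sum>k\<in>{j * s..<j * s + s}. g k powr q)"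
    and main: "d * sqrt ((P 0)\<^sup>2 + (P 1)\<^sup>2) \<le> (\<Sum>j\<in>{2..<J}. P j)"
    and M0: "0 \<le> M"
    and M1: "\<And>y. sqrt 2 * d / 2 \<le> y \<Longrightarrow> y \<le> 1 \<Longrightarrow> 2 * y \<le> M * (1 + y\<^sup>2) powr (1 / q)"
    and M2: "\<And>y. sqrt 2 * d / 2 \<le> y \<Longrightarrow> 2 * y \<le> M * (1 + y) powr (1 / q)"
  shows "d * W 0 powr (1 / q) \<le> M * (\<Sum>j\<in>{1..<J}. W j) powr (1 / q)"
proof -
  define c where "c j = g (j * s + s - 1)" for j
  have c0: "0 \<le> c j" for j by (simp add: c_def g0)
  have cg: "c j \<le> g k" if "k \<in> {j * s..<j * s + s}" for j k
    unfolding c_def using that by (intro antimonoD[OF dec]) auto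
  have gc: "g k \<le> c j" if "k \<in> {Suc j * s..<Suc j * s + s}" for j k
    unfolding c_def using that s by (intro antimonoD[OF dec]) auto
  have c_dec: "c j \<le> c 1" if "1 \<le> j" for j
    unfolding c_def using that by (intro antimonoD[OF dec] diff_le_mono add_mono mult_le_mono) auto
  have Psq: "(P j)\<^sup>2 = (\<Sum>k\<in>{j * s..<j * s + s}. (g k)\<^sup>2)" for j
    unfolding P_def by (intro real_sqrt_pow2 sum_nonneg) auto
  have P0: "0 \<le> P j" for j unfolding P_def by (intro real_sqrt_ge_zero sum_nonneg) auto
  have W0: "0 \<le> W j" for j unfolding W_def by (intro sum_nonneg) auto
  have P_lower: "real s * (c j)\<^sup>2 \<le> (P j)\<^sup>2" for j
  proof -
    have "(\<Sum>k\<in>{j * s..<j * s + s}. (c j)\<^sup>2) \<le> (P j)\<^sup>2"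
      unfolding Psq by (intro sum_mono power_mono cg c0)
    then show ?thesis by simp
  qed
  have P_upper_sq: "(P (Suc j))\<^sup>2 \<le> real s * (c j)\<^sup>2" for j
  proof -
    have "(P (Suc j))\<^sup>2 \<le> (\<Sum>k\<in>{Suc j * s..<Suc j * s + s}. (c j)\<^sup>2)"
      unfolding Psq by (intro sum_mono power_mono gc g0)
    then show ?thesis by simp
  qed
  have P_upper: "P (Suc j) \<le> sqrt s * c j" for j
    using real_sqrt_le_mono[OF P_upper_sq[of j]] P0 c0 by (simp add: real_sqrt_mult)
  have W_lower: "real s * c j powr q \<le> W j" for j
  proof -
    have "(\<Sum>k\<in>{j * s..<j * s + s}. c j powr q) \<le> W j"
      unfolding W_def using q by (intro sum_mono powr_mono2 cg c0) auto
    then show ?thesis by simp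
  qed
  define T where "T = (\<Sum>j\<in>{2..<J}. P j)"
  \<comment> \<open>The index shift pairs each norm after \<open>P 2\<close> with the least entry of
    the block before it.\<close>
  have T_split: "T = P 2 + (\<Sum>j\<in>{2..<J-1}. P (Suc j))"
  proof -
    have "T = P 2 + (\<Sum>j\<in>{Suc 2..<Suc (J - 1)}. P j)"
      unfolding T_def using J by (subst sum.atLeast_Suc_lessThan) auto
    then show ?thesis by (simp only: sum.shift_bounds_Suc_ivl)
  qed
  have T_le: "T \<le> P 2 + sqrt s * (\<Sum>j\<in>{2..<J}. c j)"
  proof -
    have "(\<Sum>j\<in>{2..<J-1}. P (Suc j)) \<le> (\<Sum>j\<in>{2..<J-1}. sqrt s * c j)"
      by (intro sum_mono P_upper)
    \<comment> \<open>The added last term is nonnegative and gives the sum the index range of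
      \<open>u\<close> below.\<close>
    also have "\<dots> \<le> (\<Sum>j\<in>{2..<J}. sqrt s * c j)"
      by (intro sum_mono2) (auto simp: c0)
    finally show ?thesis by (simp add: T_split sum_distrib_left)
  qed
  have dP0: "d * P 0 \<le> T"
  proof -
    have "P 0 \<le> sqrt ((P 0)\<^sup>2 + (P 1)\<^sup>2)" by (simp add: real_le_rsqrt)
    then show ?thesis using main d unfolding T_def by (meson mult_left_mono less_imp_le order_trans)
  qed
  show ?thesis
  \<comment> \<open>The scaling divides by \<open>c 1\<close>, and the power mean inequality needs a
    positive mean, hence \<open>P 0 > 0\<close>. If \<open>c 1 = 0\<close>, everything after block 1
    vanishes, so \<open>T = 0\<close> and \<open>main\<close> forces \<open>P 0 = 0\<close>; either
    way the head sum is 0.\<close>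
  proof (cases "c 1 = 0 \<or> P 0 = 0")
    case True
    have "P 0 = 0"
    proof (cases "P 0 = 0")
      case False
      with True have c1: "c 1 = 0" by simp
      then have "c j = 0" if "1 \<le> j" for j using c_dec[OF that] c0[of j] by simp
      moreover have "P 2 \<le> sqrt s * c 1"
        using P_upper[of 1] by (simp add: numeral_2_eq_2)
      ultimately have "T \<le> 0" using T_le c1 by simp
      then have "d * P 0 \<le> 0" using dP0 by simp
      then show ?thesis using d P0[of 0] by (simp add: mult_le_0_iff)
    qed
    then have "(\<Sum>k\<in>{0..<s}. (g k)\<^sup>2) = 0" using Psq[of 0] by simp
    then have "\<forall>k\<in>{0..<s}. g k = 0" by (subst (asm) sum_nonneg_eq_0_iff) auto
    then have "W 0 = 0" using q by (simp add: W_def)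
    then show ?thesis using M0 by simp
  next
    case False
    have c: "c 1 > 0" and P0p: "P 0 > 0" using False c0[of 1] P0[of 0] by auto
    \<comment> \<open>The unit \<open>sqrt s * c 1\<close> is the Euclidean norm of a block with all
      entries \<open>c 1\<close>. It bounds \<open>P 2\<close>, so \<open>p\<close> lies in [0, 1];
      \<open>u\<close> may be large, which is why \<open>M2\<close> has no upper limit on y.\<close>
    define p where "p = P 2 / (sqrt s * c 1)"
    define u where "u = (\<Sum>j\<in>{2..<J}. c j) / c 1"
    define y where "y = max p u"
    have sc: "0 < sqrt s * c 1" using s c by simp
    have p1: "p \<le> 1" using P_upper[of 1] sc by (simp add: p_def numeral_2_eq_2)
    have p0: "0 \<le> p" using P0 sc by (simp add: p_def)
    have u0: "0 \<le> u" using c c0 by (simp add: u_def sum_nonneg)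
    have T_y: "T \<le> sqrt s * c 1 * (2 * y)"
    proof -
      have "T \<le> sqrt s * c 1 * (p + u)"
        using T_le sc c s by (simp add: p_def u_def distrib_left)
      also have "\<dots> \<le> sqrt s * c 1 * (2 * y)"
        using sc by (intro mult_left_mono) (auto simp: y_def)
      finally show ?thesis .
    qed
    have y_lower: "sqrt 2 * d / 2 \<le> y"
    proof -
      have "c 1 \<le> c 0" unfolding c_def by (intro antimonoD[OF dec]) auto
      then have "real s * (c 1)\<^sup>2 \<le> real s * (c 0)\<^sup>2"
        using c by (intro mult_left_mono power_mono) auto
      then have "2 * (real s * (c 1)\<^sup>2) \<le> (P 0)\<^sup>2 + (P 1)\<^sup>2"
        using P_lower[of 0] P_lower[of 1] by linarith
      then have "sqrt (2 * (real s * (c 1)\<^sup>2)) \<le> sqrt ((P 0)\<^sup>2 + (P 1)\<^sup>2)"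
        by simp
      then have "d * (sqrt 2 * (sqrt s * c 1)) \<le> d * sqrt ((P 0)\<^sup>2 + (P 1)\<^sup>2)"
        using d c by (intro mult_left_mono) (auto simp: real_sqrt_mult)
      also have "\<dots> \<le> sqrt s * c 1 * (2 * y)" using main T_y by (simp add: T_def)
      finally have "sqrt s * c 1 * (d * sqrt 2) \<le> sqrt s * c 1 * (2 * y)"
        by (simp add: mult_ac)
      then have "d * sqrt 2 \<le> 2 * y" using sc by (simp only: mult_le_cancel_left_pos)
      then show ?thesis by (simp add: mult_ac)
    qed
    define Q where "Q = (\<Sum>j\<in>{1..<J}. W j)"
    have Q_split: "Q = W 1 + (\<Sum>j\<in>{2..<J}. W j)"
      unfolding Q_def using J by (subst sum.atLeast_Suc_lessThan) (auto simp: numeral_2_eq_2)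
    have Q_p: "real s * c 1 powr q * (1 + p\<^sup>2) \<le> Q"
    proof -
      \<comment> \<open>The ratios g k / c 1 lie in [0, 1], where t^2 \<le> t^q. This bounds the
        q-th power mass of block 2 from below by its Euclidean mass.\<close>
      have "c 1 powr q * ((g k)\<^sup>2 / (c 1)\<^sup>2) \<le> g k powr q" if "k \<in> {2 * s..<2 * s + s}" for k
      proof -
        have le: "g k \<le> c 1" using gc[of k 1] that by (simp add: numeral_2_eq_2)
        have "(g k / c 1)\<^sup>2 = (g k / c 1) powr 2"
          using g0[of k] c by (cases "g k = 0") simp_all
        also have "\<dots> \<le> (g k / c 1) powr q"
          using g0[of k] c le q by (intro powr_mono') auto
        finally have "c 1 powr q * (g k / c 1)\<^sup>2 \<le> c 1 powr q * (g k / c 1) powr q"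
          by (intro mult_left_mono) auto
        then show ?thesis using c g0[of k] by (simp add: powr_divide power_divide)
      qed
      then have "(\<Sum>k\<in>{2 * s..<2 * s + s}. c 1 powr q * ((g k)\<^sup>2 / (c 1)\<^sup>2)) \<le> W 2"
        unfolding W_def by (rule sum_mono)
      then have "c 1 powr q * ((P 2)\<^sup>2 / (c 1)\<^sup>2) \<le> W 2"
        by (simp add: Psq flip: sum_distrib_left sum_divide_distrib)
      moreover have ratio: "(P 2)\<^sup>2 / (c 1)\<^sup>2 = real s * p\<^sup>2"
        using s by (simp add: p_def power_divide power_mult_distrib)
      moreover have "W 2 \<le> (\<Sum>j\<in>{2..<J}. W j)"
        using J by (intro member_le_sum) (auto simp: W0)
      ultimately have "c 1 powr q * (real s * p\<^sup>2) \<le> (\<Sum>j\<in>{2..<J}. W j)"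
        unfolding ratio by linarith
      then show ?thesis
        using W_lower[of 1] by (simp add: Q_split algebra_simps)
    qed
    have Q_u: "real s * c 1 powr q * (1 + u) \<le> Q"
    proof -
      \<comment> \<open>All s entries of block j are at least \<open>c j\<close>, and t \<le> t^q on
        [0, 1] makes the lower bound linear in c j / c 1, so that it sums to
        \<open>u\<close>.\<close>
      have "real s * (c 1 powr q * (c j / c 1)) \<le> W j" if "j \<in> {2..<J}" for j
      proof -
        have le: "c j \<le> c 1" using c_dec that by simp
        have "c j / c 1 \<le> (c j / c 1) powr q"
          using powr_mono'[of q 1 "c j / c 1"] c0[of j] c le q by simp
        then have "real s * (c 1 powr q * (c j / c 1)) \<le> real s * (c 1 powr q * (c j / c 1) powr q)"
          by (intro mult_left_mono) auto
        also have "\<dots> = real s * c j powr q" using c c0[of j] by (simp add: powr_divide)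
        also have "\<dots> \<le> W j" by (rule W_lower)
        finally show ?thesis .
      qed
      then have "(\<Sum>j\<in>{2..<J}. real s * (c 1 powr q * (c j / c 1))) \<le> (\<Sum>j\<in>{2..<J}. W j)"
        by (rule sum_mono)
      then have "real s * (c 1 powr q * u) \<le> (\<Sum>j\<in>{2..<J}. W j)"
        by (simp add: u_def flip: sum_distrib_left sum_divide_distrib)
      then show ?thesis
        using W_lower[of 1] by (simp add: Q_split algebra_simps)
    qed
    \<comment> \<open>Here \<open>z\<close> stands for 1 + p^2 or 1 + u; the root turns
      \<open>c 1 powr q\<close> back into \<open>c 1\<close>.\<close>
    have root: "real s powr (1 / q) * c 1 * z powr (1 / q) \<le> Q powr (1 / q)"
      if "real s * c 1 powr q * z \<le> Q" "0 \<le> z" for z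
    proof -
      have "(real s * c 1 powr q * z) powr (1 / q) \<le> Q powr (1 / q)"
        using that q by (intro powr_mono2) auto
      then show ?thesis using that q c by (simp add: powr_mult powr_powr)
    qed
    have y_Q: "real s powr (1 / q) * c 1 * (2 * y) \<le> M * Q powr (1 / q)"
    proof (cases "u \<le> p")
      case True
      then have "y = p" by (simp add: y_def)
      then have "2 * y \<le> M * (1 + p\<^sup>2) powr (1 / q)" using M1 y_lower p1 by simp
      then have "real s powr (1 / q) * c 1 * (2 * y) \<le> real s powr (1 / q) * c 1 * (M * (1 + p\<^sup>2) powr (1 / q))"
        using c by (intro mult_left_mono) auto
      also have "\<dots> \<le> M * Q powr (1 / q)"
        using mult_left_mono[OF root[OF Q_p] M0] by (simp add: mult_ac)
      finally show ?thesis .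
    next
      case False
      then have "y = u" by (simp add: y_def)
      then have "2 * y \<le> M * (1 + u) powr (1 / q)" using M2 y_lower by simp
      then have "real s powr (1 / q) * c 1 * (2 * y) \<le> real s powr (1 / q) * c 1 * (M * (1 + u) powr (1 / q))"
        using c by (intro mult_left_mono) auto
      also have "\<dots> \<le> M * Q powr (1 / q)"
        using mult_left_mono[OF root[OF Q_u] M0] u0 by (simp add: mult_ac)
      finally show ?thesis .
    qed
    \<comment> \<open>The root mean square of block 0 is \<open>P 0 / sqrt s\<close>. The resulting
      factor s^(1/q) also appears in \<open>y_Q\<close>, and the 1 / sqrt s cancels against the
      bound on \<open>T\<close>, so no dependence on s remains.\<close>
    have "W 0 \<le> real (card {0 * s..<0 * s + s}) * (P 0 / sqrt s) powr q"
      unfolding W_def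
    proof (rule sum_powr_le_mean_square)
      show "(\<Sum>k\<in>{0 * s..<0 * s + s}. (g k)\<^sup>2) = real (card {0 * s..<0 * s + s}) * (P 0 / sqrt s)\<^sup>2"
        using s Psq[of 0] by (simp add: power_divide)
    qed (use q g0 P0p s in auto)
    then have "W 0 powr (1 / q) \<le> (real s * (P 0 / sqrt s) powr q) powr (1 / q)"
      using q W0 by (intro powr_mono2) auto
    also have "\<dots> = real s powr (1 / q) * (P 0 / sqrt s)"
      using q P0p s by (simp add: powr_mult powr_powr)
    finally have "d * W 0 powr (1 / q) \<le> d * (real s powr (1 / q) * (P 0 / sqrt s))"
      using d by (intro mult_left_mono) auto
    also have "\<dots> = real s powr (1 / q) / sqrt s * (d * P 0)" by simp
    also have "\<dots> \<le> real s powr (1 / q) / sqrt s * (sqrt s * c 1 * (2 * y))"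
      using dP0 T_y by (intro mult_left_mono) auto
    also have "\<dots> = real s powr (1 / q) * c 1 * (2 * y)" using s by simp
    also note y_Q
    finally show ?thesis by (simp add: Q_def)
  qed
qed

section \<open>Sums over index sets and decreasing enumerations\<close>

text \<open>Exchange argument at the level \<open>f s\<close>: indices of \<open>B\<close> outside
  the segment carry at most this value, indices of the segment missed by \<open>B\<close> at least
  this value, and the latter are at least as many.\<close>

lemma sum_le_sum_initial_segment:
  fixes f :: "nat \<Rightarrow> real"
  assumes dec: "antimono f" and nonneg: "\<And>k. 0 \<le> f k" and B: "finite B" "card B \<le> s"
  shows "sum f B \<le> sum f {..<s}"
proof -
  have card: "card (B - {..<s}) \<le> card ({..<s} - B)"
  proof -
    have "card B = card (B \<inter> {..<s}) + card (B - {..<s})"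
      by (rule card_Int_Diff) (rule B)
    moreover have "s = card (B \<inter> {..<s}) + card ({..<s} - B)"
      using card_Int_Diff[of "{..<s}" B] by (simp add: Int_commute)
    ultimately show ?thesis using B by linarith
  qed
  have "sum f (B - {..<s}) \<le> real (card (B - {..<s})) * f s"
    by (rule sum_bounded_above) (auto intro: antimonoD[OF dec])
  also have "\<dots> \<le> real (card ({..<s} - B)) * f s"
    using card nonneg by (intro mult_right_mono) auto
  also have "\<dots> \<le> sum f ({..<s} - B)"
    by (rule sum_bounded_below) (auto intro: antimonoD[OF dec])
  finally show ?thesis
    using sum.Int_Diff[OF B(1), of f "{..<s}"] sum.Int_Diff[of "{..<s}" f B]
    by (simp add: Int_commute)
qed

text \<open>Sorting by the negated value turns ascending into descending order. Only positions below
  the cardinality carry meaning.\<close>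

lemma decreasing_enumeration:
  fixes f :: "'a :: finite \<Rightarrow> real"
  obtains e :: "nat \<Rightarrow> 'a" where "bij_betw e {..<CARD('a)} UNIV"
    and "\<And>i j. i \<le> j \<Longrightarrow> j < CARD('a) \<Longrightarrow> f (e j) \<le> f (e i)"
proof -
  obtain xs where xs: "set xs = (UNIV :: 'a set)" "distinct xs"
    using finite_distinct_list[of "UNIV :: 'a set"] by auto
  define ys where "ys = sort_key (\<lambda>i. - f i) xs"
  have ys: "set ys = UNIV" "distinct ys" "sorted (map (\<lambda>i. - f i) ys)"
    using xs by (simp_all add: ys_def)
  have len: "length ys = CARD('a)"
    using distinct_card[OF ys(2)] ys(1) by simp
  show ?thesis
  proof
    show "bij_betw ((!) ys) {..<CARD('a)} UNIV"
      using ys by (intro bij_betw_nth) (auto simp: len)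
    show "f (ys ! j) \<le> f (ys ! i)" if "i \<le> j" "j < CARD('a)" for i j
      using sorted_nth_mono[OF ys(3), of i j] that by (simp add: len)
  qed
qed

section \<open>Restrictions of vectors and the restricted isometry bounds\<close>

lemma lq_norm_restrict_vec:
  "lq_norm q (restrict_vec h X) = (\<Sum>i\<in>X. \<bar>h $ i\<bar> powr q) powr (1 / q)"
proof -
  have "(\<Sum>i\<in>UNIV. \<bar>restrict_vec h X $ i\<bar> powr q) = (\<Sum>i\<in>UNIV. if i \<in> X then \<bar>h $ i\<bar> powr q else 0)"
    by (intro sum.cong) (auto simp: restrict_vec_def)
  then show ?thesis by (simp add: lq_norm_def sum.If_cases)
qed

lemma norm_restrict_vec: "(norm (restrict_vec h X))\<^sup>2 = (\<Sum>i\<in>X. (h $ i)\<^sup>2)"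
proof -
  have "(norm (restrict_vec h X))\<^sup>2 = (\<Sum>i\<in>UNIV. (restrict_vec h X $ i)\<^sup>2)"
    unfolding norm_vec_def L2_set_def by (simp add: sum_nonneg)
  also have "\<dots> = (\<Sum>i\<in>UNIV. if i \<in> X then (h $ i)\<^sup>2 else 0)"
    by (intro sum.cong) (auto simp: restrict_vec_def)
  finally show ?thesis by (simp add: sum.If_cases)
qed

lemma restrict_vec_union:
  assumes "X \<inter> Y = {}"
  shows "restrict_vec h (X \<union> Y) = restrict_vec h X + restrict_vec h Y"
  using assms by (auto simp: restrict_vec_def vec_eq_iff)

lemma restrict_vec_sparse:
  assumes "card X \<le> k"
  shows "restrict_vec h X \<in> sparse_vecs k"
proof -
  have "card {i. restrict_vec h X $ i \<noteq> 0} \<le> card X"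
    by (intro card_mono) (auto simp: restrict_vec_def)
  then show ?thesis using assms by (simp add: sparse_vecs_def)
qed

text \<open>Since \<open>A *v h = 0\<close>, the image of the part on \<open>Y\<close> is minus the
  sum of the images of the other parts. The lower isometry bound applies to the former, the triangle
  inequality and the upper bound to the latter.\<close>

lemma null_vector_block_bound:
  fixes A :: "real ^ 'n ^ 'm" and h :: "real ^ 'n" and X :: "nat \<Rightarrow> 'n set"
  assumes Ah: "A *v h = 0" and rip: "rip_bound A k \<delta>" and \<delta>: "0 \<le> \<delta>" "\<delta> < 1"
    and Y: "card Y \<le> k" and X: "\<And>j. j \<in> I \<Longrightarrow> card (X j) \<le> k"
    and I: "finite I" and h: "h = restrict_vec h Y + (\<Sum>j\<in>I. restrict_vec h (X j))"
  shows "sqrt ((1 - \<delta>) / (1 + \<delta>)) * norm (restrict_vec h Y) \<le> (\<Sum>j\<in>I. norm (restrict_vec h (X j)))"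
proof -
  let ?y = "restrict_vec h Y" and ?x = "\<lambda>j. restrict_vec h (X j)"
  have "A *v ?y + (\<Sum>j\<in>I. A *v ?x j) = 0"
    using Ah h by (metis matrix_vector_right_distrib linear_sum[OF matrix_vector_mul_linear])
  then have Ay: "A *v ?y = - (\<Sum>j\<in>I. A *v ?x j)"
    by (simp add: add_eq_0_iff2)
  have "(sqrt (1 - \<delta>) * norm ?y)\<^sup>2 \<le> (norm (A *v ?y))\<^sup>2"
    using rip restrict_vec_sparse[OF Y] \<delta> by (simp add: rip_bound_def power_mult_distrib)
  then have "sqrt (1 - \<delta>) * norm ?y \<le> norm (A *v ?y)"
    by (rule power2_le_imp_le) simp
  also have "\<dots> \<le> (\<Sum>j\<in>I. norm (A *v ?x j))"
    by (simp add: Ay norm_sum)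
  also have "\<dots> \<le> (\<Sum>j\<in>I. sqrt (1 + \<delta>) * norm (?x j))"
  proof (rule sum_mono)
    fix j assume "j \<in> I"
    then have "(norm (A *v ?x j))\<^sup>2 \<le> (sqrt (1 + \<delta>) * norm (?x j))\<^sup>2"
      using rip restrict_vec_sparse[OF X] \<delta> by (simp add: rip_bound_def power_mult_distrib)
    then show "norm (A *v ?x j) \<le> sqrt (1 + \<delta>) * norm (?x j)"
      by (rule power2_le_imp_le) (use \<delta> in simp)
  qed
  finally show ?thesis
    using \<delta> by (simp add: real_sqrt_divide divide_simps mult_ac flip: sum_distrib_left)
qed

section \<open>The null space inequality for a general constant\<close>

text \<open>The worst set \<open>S\<close> consists of the s largest moduli: passing to block 0 of
  the decreasing rearrangement can only enlarge the left side and shrink the right side.\<close>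

lemma nsp_inequality:
  fixes A :: "real ^ 'n ^ 'm" and h :: "real ^ 'n"
  assumes Ah: "A *v h = 0" and rip: "rip_bound A (2 * s) \<delta>" and \<delta>: "0 \<le> \<delta>" "\<delta> < 1"
    and S: "card S \<le> s" and s: "0 < s" and q: "0 < q" "q \<le> 1"
    and d_def: "d = sqrt ((1 - \<delta>) / (1 + \<delta>))"
    and M0: "0 \<le> M"
    and M1: "\<And>y. sqrt 2 * d / 2 \<le> y \<Longrightarrow> y \<le> 1 \<Longrightarrow> 2 * y \<le> M * (1 + y\<^sup>2) powr (1 / q)"
    and M2: "\<And>y. sqrt 2 * d / 2 \<le> y \<Longrightarrow> 2 * y \<le> M * (1 + y) powr (1 / q)"
  shows "d * lq_norm q (restrict_vec h S) \<le> M * lq_norm q (restrict_vec h (- S))"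
proof -
  obtain e where e: "bij_betw e {..<CARD('n)} (UNIV :: 'n set)"
    and e_dec: "\<And>i j. i \<le> j \<Longrightarrow> j < CARD('n) \<Longrightarrow> \<bar>h $ e j\<bar> \<le> \<bar>h $ e i\<bar>"
    using decreasing_enumeration[of "\<lambda>i. \<bar>h $ i\<bar>"] by metis
  define n where "n = CARD('n)"
  have inj: "inj_on e {..<n}" and surj: "e ` {..<n} = UNIV"
    using e by (auto simp: bij_betw_def n_def)
  \<comment> \<open>Padding with zeros gives every block full length s and keeps the sequence
    decreasing, as moduli are nonnegative.\<close>
  define g where "g k = (if k < n then \<bar>h $ e k\<bar> else 0)" for k
  have g0: "0 \<le> g k" for k by (simp add: g_def)
  have g_dec: "antimono g"
    by (rule antimonoI) (auto simp: g_def n_def intro: e_dec)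
  \<comment> \<open>\<open>E B\<close> is the set of coordinates whose ranks lie in
    \<open>B\<close>. Padded ranks are dropped, so sums transfer only for functions with
    \<open>\<phi> 0 = 0\<close>.\<close>
  define E where "E B = e ` (B \<inter> {..<n})" for B
  have sum_E: "(\<Sum>i\<in>E B. \<phi> \<bar>h $ i\<bar>) = (\<Sum>k\<in>B. \<phi> (g k))"
    if "finite B" "\<phi> 0 = 0" for B and \<phi> :: "real \<Rightarrow> real"
  proof -
    have "(\<Sum>i\<in>E B. \<phi> \<bar>h $ i\<bar>) = (\<Sum>k\<in>B \<inter> {..<n}. \<phi> \<bar>h $ e k\<bar>)"
      unfolding E_def by (subst sum.reindex) (auto intro: inj_on_subset[OF inj])
    also have "\<dots> = (\<Sum>k\<in>B. \<phi> (g k))"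
      using that by (intro sum.mono_neutral_cong_left) (auto simp: g_def)
    finally show ?thesis .
  qed
  have card_E: "card (E B) \<le> card B" if "finite B" for B
    unfolding E_def using that by (intro order.trans[OF card_image_le card_mono]) auto
  have norm_E: "norm (restrict_vec h (E B)) = sqrt (\<Sum>k\<in>B. (g k)\<^sup>2)" if "finite B" for B
    using norm_restrict_vec[of h "E B"] sum_E[OF that, of "\<lambda>x. x\<^sup>2"]
    by (simp add: real_sqrt_unique)
  have E_disj: "E B \<inter> E C = {}" if "B \<inter> C = {}" for B C
    unfolding E_def using that inj by (auto dest: inj_onD)
  define blk where "blk j = {j * s..<j * s + s}" for j
  \<comment> \<open>The first two blocks stay together as the head; each induction step splits off
    one more block.\<close>
  have initial: "restrict_vec h (E {..<(2 + j) * s})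
      = restrict_vec h (E {..<2 * s}) + (\<Sum>i\<in>{2..<2 + j}. restrict_vec h (E (blk i)))" for j
  proof (induction j)
    case (Suc j)
    have "{..<(2 + Suc j) * s} = {..<(2 + j) * s} \<union> blk (2 + j)"
      by (auto simp: blk_def algebra_simps)
    then have "E {..<(2 + Suc j) * s} = E {..<(2 + j) * s} \<union> E (blk (2 + j))"
      by (auto simp: E_def)
    moreover have "E {..<(2 + j) * s} \<inter> E (blk (2 + j)) = {}"
      by (rule E_disj) (auto simp: blk_def)
    ultimately have "restrict_vec h (E {..<(2 + Suc j) * s})
        = restrict_vec h (E {..<(2 + j) * s}) + restrict_vec h (E (blk (2 + j)))"
      by (simp only: restrict_vec_union)
    also note Suc.IH
    finally show ?case
      by (simp only: add_Suc_right sum.atLeastLessThan_Suc[OF le_add1] add.assoc)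
  qed simp
  \<comment> \<open>As s is at least 1, this many blocks cover all n coordinates. The shape 2 + j
    fits \<open>initial\<close>, and \<open>Suc\<close> ensures at least three blocks.\<close>
  define J where "J = 2 + Suc n"
  have nJ: "n \<le> J * s"
    using s mult_le_mono[of n J 1 s] by (simp add: J_def)
  have "E {..<J * s} = UNIV"
    using nJ surj by (simp add: E_def Int_absorb1)
  then have h_split: "h = restrict_vec h (E {..<2 * s}) + (\<Sum>j\<in>{2..<J}. restrict_vec h (E (blk j)))"
    using initial[of "Suc n"] by (simp add: J_def restrict_vec_def)
  define P where "P j = sqrt (\<Sum>k\<in>{j * s..<j * s + s}. (g k)\<^sup>2)" for j
  define W where "W j = (\<Sum>k\<in>{j * s..<j * s + s}. g k powr q)" for j
  have main: "d * sqrt ((P 0)\<^sup>2 + (P 1)\<^sup>2) \<le> (\<Sum>j\<in>{2..<J}. P j)"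
  proof -
    have "d * norm (restrict_vec h (E {..<2 * s})) \<le> (\<Sum>j\<in>{2..<J}. norm (restrict_vec h (E (blk j))))"
      unfolding d_def
    proof (rule null_vector_block_bound[OF Ah rip \<delta> _ _ _ h_split])
      show "card (E {..<2 * s}) \<le> 2 * s" using card_E[of "{..<2 * s}"] by simp
      show "card (E (blk j)) \<le> 2 * s" for j using card_E[of "blk j"] by (simp add: blk_def)
    qed simp
    moreover have "(P 0)\<^sup>2 + (P 1)\<^sup>2 = (\<Sum>k\<in>{..<2 * s}. (g k)\<^sup>2)"
      using sum.atLeastLessThan_concat[of 0 s "s + s" "\<lambda>k. (g k)\<^sup>2"]
      by (simp add: P_def sum_nonneg atLeast0LessThan mult_2)
    ultimately show ?thesis
      by (simp add: norm_E P_def blk_def)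
  qed
  have d: "0 < d" using \<delta> by (simp add: d_def)
  have core: "d * W 0 powr (1 / q) \<le> M * (\<Sum>j\<in>{1..<J}. W j) powr (1 / q)"
    by (rule decreasing_blocks_bound[OF g0 g_dec s _ q d P_def W_def main M0 M1 M2])
      (auto simp: J_def)
  define B where "B = {k. k < n \<and> e k \<in> S}"
  have EB: "E B = S" and finB: "finite B"
  proof -
    show "E B = S" using surj by (force simp: E_def B_def)
  qed (simp add: B_def)
  have cardB: "card B = card S"
  proof -
    have "card (E B) = card (B \<inter> {..<n})"
      unfolding E_def by (intro card_image inj_on_subset[OF inj]) auto
    moreover have "B \<inter> {..<n} = B" by (auto simp: B_def)
    ultimately show ?thesis by (simp add: EB)
  qed
  have sumS: "(\<Sum>i\<in>S. \<bar>h $ i\<bar> powr q) \<le> W 0"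
  proof -
    have "(\<Sum>i\<in>S. \<bar>h $ i\<bar> powr q) = (\<Sum>k\<in>B. g k powr q)"
      using sum_E[OF finB, of "\<lambda>x. x powr q"] q by (simp add: EB)
    also have "\<dots> \<le> (\<Sum>k<s. g k powr q)"
    proof (rule sum_le_sum_initial_segment)
      show "antimono (\<lambda>k. g k powr q)"
        using q g0 g_dec by (intro antimonoI powr_mono2) (auto dest: antimonoD)
    qed (use finB cardB S in auto)
    finally show ?thesis by (simp add: W_def atLeast0LessThan)
  qed
  have "(\<Sum>i\<in>UNIV. \<bar>h $ i\<bar> powr q) = (\<Sum>k<J * s. g k powr q)"
    using sum_E[of "{..<J * s}" "\<lambda>x. x powr q"] q \<open>E {..<J * s} = UNIV\<close> by simp
  also have "\<dots> = (\<Sum>j<J. W j)"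
    unfolding W_def by (simp add: sum.nat_group)
  also have "\<dots> = W 0 + (\<Sum>j\<in>{1..<J}. W j)"
    unfolding lessThan_atLeast0 by (subst sum.atLeast_Suc_lessThan) (auto simp: J_def)
  finally have total: "(\<Sum>i\<in>UNIV. \<bar>h $ i\<bar> powr q) = W 0 + (\<Sum>j\<in>{1..<J}. W j)" .
  \<comment> \<open>Both splittings have the same total, so the smaller sum over \<open>S\<close>
    leaves the larger sum over its complement.\<close>
  have "(\<Sum>i\<in>UNIV. \<bar>h $ i\<bar> powr q) = (\<Sum>i\<in>S. \<bar>h $ i\<bar> powr q) + (\<Sum>i\<in>- S. \<bar>h $ i\<bar> powr q)"
    using sum.Int_Diff[of UNIV "\<lambda>i. \<bar>h $ i\<bar> powr q" S] by (simp add: Compl_eq_Diff_UNIV)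
  with total sumS have sumC: "(\<Sum>j\<in>{1..<J}. W j) \<le> (\<Sum>i\<in>- S. \<bar>h $ i\<bar> powr q)"
    by linarith
  have W0: "0 \<le> W j" for j by (auto simp: W_def intro: sum_nonneg)
  have "d * lq_norm q (restrict_vec h S) \<le> d * W 0 powr (1 / q)"
    unfolding lq_norm_restrict_vec
    using sumS d q by (intro mult_left_mono powr_mono2) (auto intro: sum_nonneg)
  also note core
  also have "M * (\<Sum>j\<in>{1..<J}. W j) powr (1 / q) \<le> M * lq_norm q (restrict_vec h (- S))"
    unfolding lq_norm_restrict_vec
    using sumC M0 q W0 by (intro mult_left_mono powr_mono2) (auto intro: sum_nonneg)
  finally show ?thesis .
qed

section \<open>Bounds for the constant a\<close>

text \<open>The expression under the infimum in \<open>a_fun\<close>, named so that estimates can be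
  made for one r at a time.\<close>

definition a_max :: "real \<Rightarrow> real \<Rightarrow> real \<Rightarrow> real" where
  "a_max q \<delta> r =
     max ((1 + r * \<delta>) / (1 + r powr q * \<delta> powr q) powr (1 / q))
    (max (SUP y\<in>{sqrt 2 * (1 - r) * \<delta> / 2..1}.
            2 * y / (1 + 2 powr (- q / 2) * y powr (2 + q)) powr (1 / q))
    (max (SUP y\<in>{sqrt 2 * (1 - r) * \<delta> / 2..1}. 3 * y / (1 + y) powr (1 / q))
         (SUP y\<in>{1..}. 2 * y / (1 + y) powr (1 / q))))"

lemma a_fun_eq: "a_fun q \<delta> = (INF r\<in>{0<..<1}. a_max q \<delta> r)"
  unfolding a_fun_def a_max_def ..

text \<open>A real supremum dominates its members only once the family is bounded above; the bounds
  here are 2, 3 and 2. The conditions on r and d keep the range of y nonnegative.\<close>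

lemma a_max_bounds:
  assumes q: "0 < q" "q \<le> 1" and r: "r < 1" and d: "0 \<le> d"
  shows "\<And>y. sqrt 2 * (1 - r) * d / 2 \<le> y \<Longrightarrow> y \<le> 1 \<Longrightarrow>
            2 * y / (1 + 2 powr (- q / 2) * y powr (2 + q)) powr (1 / q) \<le> a_max q d r"
    and "\<And>y. sqrt 2 * (1 - r) * d / 2 \<le> y \<Longrightarrow> y \<le> 1 \<Longrightarrow> 3 * y / (1 + y) powr (1 / q) \<le> a_max q d r"
    and "\<And>y. 1 \<le> y \<Longrightarrow> 2 * y / (1 + y) powr (1 / q) \<le> a_max q d r"
proof -
  let ?l = "sqrt 2 * (1 - r) * d / 2"
  have l0: "0 \<le> ?l" using r d by simp
  have div: "x / z \<le> x" if "0 \<le> x" "1 \<le> z" for x z :: real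
    using that by (simp add: divide_le_eq mult_le_cancel_left1 order_trans[of 0 1 z])
  note le_max_iff_disj[simp]
  show "2 * y / (1 + 2 powr (- q / 2) * y powr (2 + q)) powr (1 / q) \<le> a_max q d r"
    if "?l \<le> y" "y \<le> 1" for y
  proof -
    have "bdd_above ((\<lambda>y. 2 * y / (1 + 2 powr (- q / 2) * y powr (2 + q)) powr (1 / q)) ` {?l..1})"
    proof (rule bdd_aboveI2)
      fix y assume y: "y \<in> {?l..1}"
      then have "0 \<le> y" using l0 by simp
      then have "2 * y / (1 + 2 powr (- q / 2) * y powr (2 + q)) powr (1 / q) \<le> 2 * y"
        using q by (intro div ge_one_powr_ge_zero) auto
      then show "2 * y / (1 + 2 powr (- q / 2) * y powr (2 + q)) powr (1 / q) \<le> 2" using y by simp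
    qed
    then have "2 * y / (1 + 2 powr (- q / 2) * y powr (2 + q)) powr (1 / q)
      \<le> (SUP y\<in>{?l..1}. 2 * y / (1 + 2 powr (- q / 2) * y powr (2 + q)) powr (1 / q))"
      using that by (intro cSUP_upper) auto
    then show ?thesis unfolding a_max_def by simp
  qed
  show "3 * y / (1 + y) powr (1 / q) \<le> a_max q d r" if "?l \<le> y" "y \<le> 1" for y
  proof -
    have "bdd_above ((\<lambda>y. 3 * y / (1 + y) powr (1 / q)) ` {?l..1})"
    proof (rule bdd_aboveI2)
      fix y assume y: "y \<in> {?l..1}"
      then have "0 \<le> y" using l0 by simp
      then have "3 * y / (1 + y) powr (1 / q) \<le> 3 * y"
        using q by (intro div ge_one_powr_ge_zero) auto
      then show "3 * y / (1 + y) powr (1 / q) \<le> 3" using y by simp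
    qed
    then have "3 * y / (1 + y) powr (1 / q) \<le> (SUP y\<in>{?l..1}. 3 * y / (1 + y) powr (1 / q))"
      using that by (intro cSUP_upper) auto
    then show ?thesis unfolding a_max_def by simp
  qed
  show "2 * y / (1 + y) powr (1 / q) \<le> a_max q d r" if "1 \<le> y" for y
  proof -
    have "bdd_above ((\<lambda>y. 2 * y / (1 + y) powr (1 / q)) ` {1..})"
    proof (rule bdd_aboveI2)
      fix y :: real assume y: "y \<in> {1..}"
      \<comment> \<open>As 1 / q is at least 1, the denominator grows at least linearly, which
        bounds the quotient on the unbounded range.\<close>
      then have "(1 + y) powr 1 \<le> (1 + y) powr (1 / q)"
        using q by (intro powr_mono) auto
      then have "2 * y \<le> 2 * (1 + y) powr (1 / q)" using y by simp
      then show "2 * y / (1 + y) powr (1 / q) \<le> 2" using y by (simp add: divide_le_eq)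
    qed
    then have "2 * y / (1 + y) powr (1 / q) \<le> (SUP y\<in>{1..}. 2 * y / (1 + y) powr (1 / q))"
      using that by (intro cSUP_upper) auto
    then show ?thesis unfolding a_max_def by simp
  qed
qed

lemma a_fun_greatest:
  assumes "\<And>r. 0 < r \<Longrightarrow> r < 1 \<Longrightarrow> K \<le> a_max q d r"
  shows "K \<le> a_fun q d"
  unfolding a_fun_eq by (rule cINF_greatest) (use assms in auto)

text \<open>The fourth term at y = 1 gives a positive lower bound independent of r. Positivity is
  required of every admissible null space bound.\<close>

lemma a_fun_pos:
  assumes "0 < q" "q \<le> 1" "0 \<le> d"
  shows "0 < a_fun q d"
proof -
  have "2 / 2 powr (1 / q) \<le> a_fun q d"
    using a_max_bounds(3)[of q _ d 1] assms by (intro a_fun_greatest) auto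
  moreover have "0 < 2 / (2 :: real) powr (1 / q)" by simp
  ultimately show ?thesis by linarith
qed

section \<open>Null space property and null space constant\<close>

text \<open>Every r in (0, 1) makes \<open>a_max q d r\<close> an admissible constant M; the infimum
  over r is taken at the end.\<close>

lemma nsp_inequality_a_fun:
  fixes A :: "real ^ 'n ^ 'm" and h :: "real ^ 'n"
  assumes Ah: "A *v h = 0" and rip: "rip_bound A (2 * s) \<delta>" and \<delta>: "0 \<le> \<delta>" "\<delta> < 1"
    and S: "card S \<le> s" and s: "0 < s" and q: "0 < q" "q \<le> 1"
    and d_def: "d = sqrt ((1 - \<delta>) / (1 + \<delta>))"
  shows "d * lq_norm q (restrict_vec h S) \<le> a_fun q d * lq_norm q (restrict_vec h (- S))"
proof -
  have d: "0 < d" using \<delta> by (simp add: d_def)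
  let ?L = "lq_norm q (restrict_vec h S)" and ?R = "lq_norm q (restrict_vec h (- S))"
  have R0: "0 \<le> ?R" by (simp add: lq_norm_def)
  have bound: "d * ?L \<le> a_max q d r * ?R" if r: "0 < r" "r < 1" for r
  proof (rule nsp_inequality[OF Ah rip \<delta> S s q d_def])
    note M = a_max_bounds[OF q r(2) less_imp_le[OF d]]
    show M0: "0 \<le> a_max q d r"
      using M(3)[of 1] order_trans[of 0 "2 / 2 powr (1 / q)" "a_max q d r"] by simp
    have lower: "sqrt 2 * (1 - r) * d / 2 \<le> y" if "sqrt 2 * d / 2 \<le> y" for y
    proof -
      have "sqrt 2 * (1 - r) * d \<le> sqrt 2 * d"
        using r d by (simp add: mult_left_le)
      then show ?thesis using that by linarith
    qed
    have pos: "0 < y" if "sqrt 2 * d / 2 \<le> y" for y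
      using that d by (smt (verit) divide_pos_pos mult_pos_pos real_sqrt_gt_zero)
    show "2 * y \<le> a_max q d r * (1 + y\<^sup>2) powr (1 / q)" if y: "sqrt 2 * d / 2 \<le> y" "y \<le> 1" for y
    proof -
      let ?D = "1 + 2 powr (- q / 2) * y powr (2 + q)"
      have y0: "0 < y" using pos y by simp
      \<comment> \<open>For y \<le> 1 the denominator in the second term of a is at most (1 +
        y^2)^(1/q), so the bound by that supremum implies the one needed.\<close>
      have "2 powr (- q / 2) * y powr (2 + q) \<le> 1 * y powr 2"
      proof (intro mult_mono)
        show "2 powr (- q / 2) \<le> (1 :: real)" using q powr_mono[of "- q / 2" 0 2] by simp
        show "y powr (2 + q) \<le> y powr 2" using y y0 q by (intro powr_mono') auto
      qed auto
      then have D: "?D \<le> 1 + y\<^sup>2" using y0 by simp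
      have D1: "1 \<le> ?D" by simp
      have "0 < ?D powr (1 / q)" using D1 by (subst powr_gt_zero) linarith
      then have "2 * y \<le> a_max q d r * ?D powr (1 / q)"
        using M(1)[OF lower[OF y(1)] y(2)] by (simp only: pos_divide_le_eq)
      also have "\<dots> \<le> a_max q d r * (1 + y\<^sup>2) powr (1 / q)"
        using D D1 q M0 by (intro mult_left_mono powr_mono2) auto
      finally show ?thesis .
    qed
    show "2 * y \<le> a_max q d r * (1 + y) powr (1 / q)" if y: "sqrt 2 * d / 2 \<le> y" for y
    proof (cases "y \<le> 1")
      case True
      have "3 * y \<le> a_max q d r * (1 + y) powr (1 / q)"
        using M(2)[OF lower[OF y] True] pos[OF y] by (simp add: pos_divide_le_eq)
      then show ?thesis using pos[OF y] by linarith
    next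
      case False
      then show ?thesis using M(3)[of y] by (simp add: pos_divide_le_eq)
    qed
  qed
  show ?thesis
  \<comment> \<open>Passing to the infimum requires dividing by \<open>?R\<close>. When it is 0, a
    single value of r already gives the claim.\<close>
  proof (cases "?R = 0")
    case True
    then show ?thesis using bound[of "1 / 2"] by simp
  next
    case False
    then have "0 < ?R" using R0 by simp
    then have "d * ?L / ?R \<le> a_fun q d"
      using bound by (intro a_fun_greatest) (simp add: pos_divide_le_eq)
    then show ?thesis using \<open>0 < ?R\<close> by (simp add: pos_divide_le_eq)
  qed
qed

theorem theorem1p4:
  fixes A :: "real ^ 'n ^ 'm" and q :: real and s :: nat
  defines "\<delta>\<^sub>1 \<equiv> sqrt ((1 - rip_const A (2 * s)) / (1 + rip_const A (2 * s)))"
  assumes "0 < q" and "q \<le> 1"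
    and "2 \<le> 2 * s" and "2 * s \<le> CARD('m)" and "CARD('m) \<le> CARD('n)"
    and "0 < rip_const A (2 * s)" and "rip_const A (2 * s) < 1"
  shows "null_space_property A s q \<and> null_space_const A s q \<le> a_fun q \<delta>\<^sub>1 / \<delta>\<^sub>1"
proof -
  have pos: "0 < \<delta>\<^sub>1" using assms by (simp add: \<delta>\<^sub>1_def)
  have "lq_norm q (restrict_vec h S) \<le> a_fun q \<delta>\<^sub>1 / \<delta>\<^sub>1 * lq_norm q (restrict_vec h (- S))"
    if "A *v h = 0" "card S \<le> s" for h S
  proof -
    have "\<delta>\<^sub>1 * lq_norm q (restrict_vec h S) \<le> a_fun q \<delta>\<^sub>1 * lq_norm q (restrict_vec h (- S))"
      \<comment> \<open>The restricted isometry constant is attained, so it satisfies the isometry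
        bounds itself.\<close>
      by (rule nsp_inequality_a_fun[OF that(1) rip_const_least(2) _ _ that(2)])
        (use assms in \<open>auto simp: \<delta>\<^sub>1_def\<close>)
    then show ?thesis using pos by (simp add: field_simps)
  qed
  then have "nsp_bound A s q (a_fun q \<delta>\<^sub>1 / \<delta>\<^sub>1)" by (simp add: nsp_bound_def)
  moreover have "0 < a_fun q \<delta>\<^sub>1 / \<delta>\<^sub>1"
    using pos a_fun_pos[of q \<delta>\<^sub>1] assms(2,3) by simp
  ultimately show ?thesis
    \<comment> \<open>One constant serves twice: it witnesses the property and belongs to the set,
      bounded below by 0, whose infimum is the null space constant.\<close>
    unfolding null_space_property_def null_space_const_def
    by (intro conjI exI[of _ "a_fun q \<delta>\<^sub>1 / \<delta>\<^sub>1"] cInf_lower bdd_belowI[of _ 0]) auto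
qed

end
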